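(* Let $m\in\{1,2,3,\dots\}$, let $a,b,c,d\in\mathbb{R}$ with $c\neq 0$, and let $f:\mathbb{C}\to\mathbb{C}$, $f(z)=(a+bz\bar z+ci)z+d\,\bar z^{\,m-1}$ (the cyclic logistic map). Let $q\in(0,1)$ and let $z_0=x(0)+iy(0)$ with $x(0),y(0)\in\mathbb{R}$ and $y(0)\neq 0$. Then the fractional-order map of order $q$ associated with $f$ and the initial value $z_0$ has no cyclic ($C_m$) symmetry.
   Context: $i^2=-1$. For $q\in(0,1)$, the Caputo fractional difference with starting point $0$ is $\Delta_*^q u(t)=\frac{1}{\Gamma(1-q)}\sum_{s=0}^{t-(1-q)}(t-s-1)^{(-q)}\Delta u(s)$, where $\Delta u(s)=u(s+1)-u(s)$ and $t^{(p)}=\frac{\Gamma(t+1)}{\Gamma(t-p+1)}$ (with the convention that division at a pole yields zero). The fractional-order (FO) variant of $f$ is given by the Caputo discrete initial value problem $\Delta_*^q z(t)=f(z(t+q-1))$, $t\in\{1-q,2-q,\dots\}$, $z(0)=z_0$, whose solution satisfies $z(n)=\Phi_n(z)$ for $n\ge 1$. Here, for the fixed initial value $z_0$ and any sequence $z=(z(0),z(1),z(2),\dots)$ of complex numbers, $$\Phi_n(z)=z_0+\frac{1}{\Gamma(q)}\sum_{k=1}^n\frac{\Gamma(n-k+q)}{\Gamma(n-k+1)}f(z(k-1)),\qquad n=1,2,3,\dots$$ Let $R_1(w)=\mathrm{e}^{2\pi i/m}w$ (rotation by $2\pi/m$), the generator of the cyclic group $C_m$, whose only symmetries are rotations; it acts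 on sequences termwise, $(R_1 z)(n)=R_1(z(n))$. The FO map associated with $f$ and $z_0$ has cyclic symmetry if $\Phi_n(R_1 z)=R_1(\Phi_n(z))$ for all $n\ge 1$ and all complex sequences $z$, where the additive term $z_0$ in $\Phi_n$ is kept fixed.
   Formalization: The case m = 1 is excluded (m ≥ 2 is assumed): for m = 1 the rotation by 2π is the identity, so the C_1 symmetry always holds and the claim as stated is false there. *)

theory Defs
  imports "HOL-Analysis.Analysis"
begin

definition cyclic_logistic ::
  "nat \<Rightarrow> real \<Rightarrow> real \<Rightarrow> real \<Rightarrow> real \<Rightarrow> complex \<Rightarrow> complex" where
  "cyclic_logistic m a b c d z =
     (of_real a + of_real b * z * cnj z + of_real c * \<i>) * z + of_real d * cnj z ^ (m - 1)"

definition rot :: "nat \<Rightarrow> complex \<Rightarrow> complex" where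
  "rot m w = exp (2 * of_real pi * \<i> / of_nat m) * w"

(* Right-hand side of the summation form z(n) = fo_map q f z0 n z, n \<ge> 1, of the Caputo discrete
   initial value problem of order q with right-hand side f and z(0) = z0.  The additive term z0 is
   a parameter, independent of the entry z 0 of the argument sequence. *)
definition fo_map ::
  "real \<Rightarrow> (complex \<Rightarrow> complex) \<Rightarrow> complex \<Rightarrow> nat \<Rightarrow> (nat \<Rightarrow> complex) \<Rightarrow> complex" where
  "fo_map q f z0 n z =
     z0 + of_real (1 / Gamma q) *
       (\<Sum>k = 1..n. of_real (Gamma (real n - real k + q) / Gamma (real n - real k + 1)) * f (z (k - 1)))"

definition fo_cyclic_symmetric ::
  "nat \<Rightarrow> real \<Rightarrow> (complex \<Rightarrow> complex) \<Rightarrow> complex \<Rightarrow> bool" where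
  "fo_cyclic_symmetric m q f z0 \<longleftrightarrow>
     (\<forall>n \<ge> 1. \<forall>z :: nat \<Rightarrow> complex.
        fo_map q f z0 n (\<lambda>j. rot m (z j)) = rot m (fo_map q f z0 n z))"

end

theory Submission
  imports Defs
begin

text \<open>The additive term \<open>z0\<close> is not rotated on the left of the symmetry condition, and already the
  zero sequence shows this: \<open>cyclic_logistic\<close> fixes \<open>0\<close>, so symmetry would force \<open>z0 = rot m z0\<close>
  although \<open>z0 \<noteq> 0\<close> and the rotation is nontrivial.\<close>

text \<open>Otherwise the exponent is an integer multiple of \<open>2 * pi * \<i>\<close>, so
  \<open>1 / m\<close> is an integer and \<open>m\<close> divides 1.\<close>

lemma exp_root_of_unity_ne_1:
  assumes "m \<ge> 2"
  shows "exp (2 * of_real pi * \<i> / of_nat m) \<noteq> (1 :: complex)"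
proof
  assume "exp (2 * of_real pi * \<i> / of_nat m) = (1 :: complex)"
  then obtain k :: int where "2 * pi / real m = of_int (2 * k) * pi"
    unfolding exp_eq_1 by auto
  then have "1 = real_of_int (k * int m)"
    using assms by (simp add: field_simps)
  then have "k * int m = 1"
    by linarith
  then have "int m dvd 1"
    by (metis dvd_triv_right)
  with assms show False
    by simp
qed

lemma rot_eq_self_iff:
  assumes "m \<ge> 2"
  shows "rot m w = w \<longleftrightarrow> w = 0"
  using exp_root_of_unity_ne_1[OF assms] by (simp add: rot_def)

text \<open>The bound makes the exponent \<open>m - 1\<close> positive; for \<open>m = 1\<close> the
  last term is the constant \<open>d\<close>, as \<open>0 ^ 0 = 1\<close>.\<close>

lemma cyclic_logistic_0:
  assumes "m \<ge> 2"
  shows "cyclic_logistic m a b c d 0 = 0"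
  using assms by (simp add: cyclic_logistic_def)

lemma fo_map_zero_sequence:
  assumes "f 0 = 0"
  shows "fo_map q f z0 n (\<lambda>_. 0) = z0"
  using assms by (simp add: fo_map_def)

lemma fo_cyclic_symmetric_imp_initial_value_0:
  assumes "m \<ge> 2" and "f 0 = 0" and "fo_cyclic_symmetric m q f z0"
  shows "z0 = 0"
proof -
  have "fo_map q f z0 1 (\<lambda>_. rot m 0) = rot m (fo_map q f z0 1 (\<lambda>_. 0))"
    using assms(3)[unfolded fo_cyclic_symmetric_def, rule_format, of 1 "\<lambda>_. 0"] by simp
  moreover have "rot m 0 = 0"
    by (simp add: rot_def)
  ultimately have "rot m z0 = z0"
    by (simp add: fo_map_zero_sequence assms(2))
  then show ?thesis
    by (simp add: rot_eq_self_iff assms(1))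
qed

text \<open>The case \<open>m = 1\<close> must be excluded: \<open>rot 1\<close> is the identity, so
  every map is then trivially symmetric.\<close>

theorem theorem7:
  fixes m :: nat and a b c d q x0 y0 :: real and z0 :: complex
  assumes "m \<ge> 2"
    and "c \<noteq> 0"
    and "0 < q" and "q < 1"
    and "z0 = of_real x0 + \<i> * of_real y0"
    and "y0 \<noteq> 0"
  shows "\<not> fo_cyclic_symmetric m q (cyclic_logistic m a b c d) z0"
proof
  assume "fo_cyclic_symmetric m q (cyclic_logistic m a b c d) z0"
  then have "z0 = 0"
    using assms(1) cyclic_logistic_0 fo_cyclic_symmetric_imp_initial_value_0 by blast
  then show False
    using assms(5,6) by (simp add: complex_eq_iff)
qed

end
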